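(* There exists a family of undirected multigraphs $G$, each equipped with a greedy tree packing, such that, writing $n$ for the number of vertices and $\lambda$ for the edge connectivity of $G$, the relative loads satisfy $\|x^k-x^*\|_\infty\ge\Omega\big(\sqrt{1/(k\lambda)}\big)$ for $k=O(n^2)$, where the constants implicit in $\Omega(\cdot)$ and $O(\cdot)$ are absolute.
   Context: For a connected multigraph $G=(V,E)$, a greedy tree packing is a sequence of spanning trees $T_1,T_2,\ldots$ such that $T_j$ is a minimum-weight spanning tree with respect to the weights $w_j(e)=|\{i<j: e\in T_i\}|$ (with some tie-breaking rule). The relative loads after $k$ trees are $x^k\in\mathbb{R}^E$, $x^k_e=\frac1k|\{i\le k: e\in T_i\}|$. The ideal loads vector $x^*$ is the point of the spanning tree polytope of $G$ (convex hull of indicator vectors of spanning trees) with minimum Euclidean norm; equivalently $x^*=\lim_{k\to\infty}x^k$. *)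

theory Defs
  imports "HOL-Analysis.Analysis" "HOL-Analysis.Finite_Function_Topology"
begin

text \<open>Finite undirected multigraphs: edges are named objects, so parallel edges are
  distinct edges with the same pair of endpoints. There are no self-loops.\<close>

record ('v, 'e) multigraph =
  verts :: "'v set"
  edges :: "'e set"
  ends :: "'e \<Rightarrow> 'v set"

definition wf_multigraph :: "('v, 'e) multigraph \<Rightarrow> bool" where
  "wf_multigraph G \<longleftrightarrow> finite (verts G) \<and> finite (edges G) \<and>
     (\<forall>e\<in>edges G. ends G e \<subseteq> verts G \<and> card (ends G e) = 2)"

definition adj :: "('v, 'e) multigraph \<Rightarrow> 'e set \<Rightarrow> ('v \<times> 'v) set" where
  "adj G F = {(u, v). \<exists>e\<in>F. ends G e = {u, v}}"

definition connected_by :: "('v, 'e) multigraph \<Rightarrow> 'e set \<Rightarrow> bool" where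
  "connected_by G F \<longleftrightarrow> verts G \<noteq> {} \<and> (\<forall>u\<in>verts G. \<forall>v\<in>verts G. (u, v) \<in> (adj G F)\<^sup>*)"

text \<open>\<open>cycle_in G F vs es\<close>: the edge \<open>es ! i\<close> joins the \<open>i\<close>-th vertex to its cyclic successor.
  Two parallel edges form a cycle of length 2.\<close>

definition cycle_in :: "('v, 'e) multigraph \<Rightarrow> 'e set \<Rightarrow> 'v list \<Rightarrow> 'e list \<Rightarrow> bool" where
  "cycle_in G F vs es \<longleftrightarrow> es \<noteq> [] \<and> length vs = length es \<and> distinct vs \<and> distinct es \<and>
     set es \<subseteq> F \<and> (\<forall>i<length es. ends G (es ! i) = {vs ! i, vs ! (Suc i mod length vs)})"

definition spanning_tree :: "('v, 'e) multigraph \<Rightarrow> 'e set \<Rightarrow> bool" where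
  "spanning_tree G T \<longleftrightarrow> T \<subseteq> edges G \<and> connected_by G T \<and> (\<nexists>vs es. cycle_in G T vs es)"

definition min_spanning_tree :: "('v, 'e) multigraph \<Rightarrow> ('e \<Rightarrow> nat) \<Rightarrow> 'e set \<Rightarrow> bool" where
  "min_spanning_tree G w T \<longleftrightarrow> spanning_tree G T \<and>
     (\<forall>T'. spanning_tree G T' \<longrightarrow> (\<Sum>e\<in>T. w e) \<le> (\<Sum>e\<in>T'. w e))"

text \<open>Meaningful for graphs with at least two vertices.\<close>

definition edge_connectivity :: "('v, 'e) multigraph \<Rightarrow> nat" where
  "edge_connectivity G = Min (card ` {F. F \<subseteq> edges G \<and> \<not> connected_by G (edges G - F)})"

text \<open>Trees are numbered from 1; the value \<open>T 0\<close> is never used. Ties between minimum spanning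
  trees may be broken arbitrarily in every step.\<close>

definition greedy_tree_packing :: "('v, 'e) multigraph \<Rightarrow> (nat \<Rightarrow> 'e set) \<Rightarrow> bool" where
  "greedy_tree_packing G T \<longleftrightarrow>
     (\<forall>j\<ge>1. min_spanning_tree G (\<lambda>e. card {i. 1 \<le> i \<and> i < j \<and> e \<in> T i}) (T j))"

definition relative_load :: "(nat \<Rightarrow> 'e set) \<Rightarrow> nat \<Rightarrow> 'e \<Rightarrow> real" where
  "relative_load T k e = real (card {i. 1 \<le> i \<and> i \<le> k \<and> e \<in> T i}) / real k"

text \<open>Vectors indexed by the edges are finitely supported functions, which form a real vector
  space for every edge type; all vectors below vanish outside \<open>edges G\<close>.\<close>

definition indicator_vec :: "'e set \<Rightarrow> ('e, real) poly_mapping" where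
  "indicator_vec T = (\<Sum>e\<in>T. Poly_Mapping.single e 1)"

definition spanning_tree_polytope :: "('v, 'e) multigraph \<Rightarrow> ('e, real) poly_mapping set" where
  "spanning_tree_polytope G = convex hull (indicator_vec ` {T. spanning_tree G T})"

text \<open>For a connected multigraph the minimizer exists (compactness) and is unique
  (strict convexity of the squared norm).\<close>

definition ideal_loads :: "('v, 'e) multigraph \<Rightarrow> ('e, real) poly_mapping" where
  "ideal_loads G = arg_min_on (\<lambda>x. L2_set (Poly_Mapping.lookup x) (edges G)) (spanning_tree_polytope G)"

definition load_error :: "('v, 'e) multigraph \<Rightarrow> (nat \<Rightarrow> 'e set) \<Rightarrow> nat \<Rightarrow> real" where
  "load_error G T k =
     (MAX e\<in>edges G. \<bar>relative_load T k e - Poly_Mapping.lookup (ideal_loads G) e\<bar>)"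

end

theory Submission
  imports Defs
begin

text \<open>The graph is a fan: a path \<open>1, ..., n\<close> whose vertices are all joined to a hub \<open>0\<close>, where the
  path starts at the hub and ends in a pendant edge to \<open>n + 1\<close>, and every edge is replaced by \<open>l\<close>
  parallel copies. The pendant edge makes the connectivity equal to \<open>l\<close>. Site \<open>t\<close> consists of the edges
  that join \<open>t\<close> to \<open>t - 1\<close> and to the hub; every prefix of the sites is tight, so all ideal
  loads except that of the pendant edge are \<open>1 / (2 * l)\<close>.

  For \<open>l = 1\<close>, whenever the four edges of two neighbouring sites are tied, ties are broken so that
  one tree edge moves across the boundary from the lower to the higher site. A prefix of the sites can lose
  edges in this way but never regain them. The site loads stay nondecreasing in \<open>t\<close>, and two sites with
  equal loads exchange an edge in one of any two consecutive steps. Hence as long as the first site lags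
  behind by less than \<open>j\<close>, about \<open>j\<close> boundaries among the first \<open>4 * j\<close> sites carry flux, although the
  total flux across each of them is at most \<open>4 * j\<^sup>2\<close>; so this lasts for \<open>O(j\<^sup>2)\<close> steps
  only, and after \<open>i\<close> steps the lag is of order \<open>sqrt i\<close>. For general \<open>l\<close> each of these trees is
  used \<open>l\<close> times in a row, once for each copy, and \<open>i = k div l\<close>.\<close>

section \<open>Spanning trees\<close>

lemma adj_mono: "F \<subseteq> F' \<Longrightarrow> adj G F \<subseteq> adj G F'"
  by (auto simp: adj_def)

lemma connected_by_mono: "connected_by G F \<Longrightarrow> F \<subseteq> F' \<Longrightarrow> connected_by G F'"
  unfolding connected_by_def using rtrancl_mono[OF adj_mono] by blast

text \<open>Starting from \<open>R\<close>, vertices are added one at a time along an edge of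
  \<open>F\<close> leaving the current set. That edge lies inside the enlarged set, so no edge is
  counted twice.\<close>

lemma card_edges_leaving_ge:
  assumes wf: "wf_multigraph G" and F: "F \<subseteq> edges G" and con: "connected_by G F"
    and "R \<subseteq> verts G" "R \<noteq> {}"
  shows "card (verts G - R) \<le> card {e \<in> F. \<not> ends G e \<subseteq> R}"
  using assms(4,5)
proof (induction "card (verts G - R)" arbitrary: R)
  case 0
  then show ?case by simp
next
  case (Suc m)
  have fin: "finite (verts G)" "finite F"
    using wf F by (auto simp: wf_multigraph_def intro: finite_subset)
  have "verts G - R \<noteq> {}" using Suc.hyps(2) by (metis card.empty nat.distinct(1))
  then obtain y where y: "y \<in> verts G" "y \<notin> R" by blast
  obtain x where x: "x \<in> R" "x \<in> verts G" using Suc.prems by blast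
  have "(x, y) \<in> (adj G F)\<^sup>*"
    using con x y by (auto simp: connected_by_def)
  then have "y \<in> R \<or> (\<exists>u v. u \<in> R \<and> v \<notin> R \<and> (u, v) \<in> adj G F)"
    using x(1) by (induction rule: rtrancl_induct) blast+
  then obtain u v e where uv: "u \<in> R" "v \<notin> R" and e: "e \<in> F" "ends G e = {u, v}"
    using y(2) by (auto simp: adj_def)
  have "ends G e \<subseteq> verts G" using wf F e(1) unfolding wf_multigraph_def by blast
  then have v: "v \<in> verts G" using e(2) by simp
  let ?R = "insert v R"
  have eq: "verts G - R = insert v (verts G - ?R)" using uv v by blast
  have c: "card (verts G - R) = Suc (card (verts G - ?R))"
    unfolding eq using fin by (intro card_insert_disjoint) auto
  then have "m = card (verts G - ?R)" using Suc.hyps(2) by simp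
  then have "card (verts G - ?R) \<le> card {e \<in> F. \<not> ends G e \<subseteq> ?R}"
    using Suc.hyps(1)[of ?R] v Suc.prems by simp
  also have "\<dots> < card {e \<in> F. \<not> ends G e \<subseteq> R}"
  proof (rule psubset_card_mono)
    show "finite {e \<in> F. \<not> ends G e \<subseteq> R}" using fin by simp
    have "e \<in> {e \<in> F. \<not> ends G e \<subseteq> R}" "e \<notin> {e \<in> F. \<not> ends G e \<subseteq> ?R}"
      using e uv by simp_all
    then show "{e \<in> F. \<not> ends G e \<subseteq> ?R} \<subset> {e \<in> F. \<not> ends G e \<subseteq> R}" by blast
  qed
  finally show ?case using c by simp
qed

text \<open>Following parents lowers the rank and thus reaches \<open>r\<close>. On a cycle, a
  vertex of maximal rank would be the child end of both incident cycle edges, so these would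
  coincide.\<close>

lemma
  fixes \<rho> :: "'v \<Rightarrow> nat"
  assumes wf: "wf_multigraph G" and r: "r \<in> verts G"
    and pe: "\<And>v. v \<in> verts G - {r} \<Longrightarrow> pe v \<in> edges G \<and> ends G (pe v) = {v, par v}
      \<and> par v \<in> verts G \<and> \<rho> (par v) < \<rho> v"
  shows spanning_tree_parent_edges: "spanning_tree G (pe ` (verts G - {r}))" (is "spanning_tree G ?T")
    and inj_on_parent_edges: "inj_on pe (verts G - {r})"
proof -
  show "inj_on pe (verts G - {r})"
  proof (rule inj_onI)
    fix u v assume uv: "u \<in> verts G - {r}" "v \<in> verts G - {r}" "pe u = pe v"
    then have "{u, par u} = {v, par v}" using pe by metis
    moreover have "\<rho> (par u) < \<rho> u" "\<rho> (par v) < \<rho> v" using uv pe by auto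
    ultimately show "u = v" by (auto simp: doubleton_eq_iff)
  qed
  have sym: "sym (adj G ?T)" by (auto simp: sym_def adj_def insert_commute)
  have to_root: "v \<in> verts G \<Longrightarrow> (v, r) \<in> (adj G ?T)\<^sup>*" for v
  proof (induction "\<rho> v" arbitrary: v rule: less_induct)
    case less
    show ?case
    proof (cases "v = r")
      case False
      with less.prems have v: "v \<in> verts G - {r}" by simp
      have "(v, par v) \<in> adj G ?T" using pe[OF v] v by (auto simp: adj_def)
      then show ?thesis using less.hyps[of "par v"] pe[OF v] by (meson converse_rtrancl_into_rtrancl)
    qed simp
  qed
  have "(u, v) \<in> (adj G ?T)\<^sup>*" if "u \<in> verts G" "v \<in> verts G" for u v
    using to_root[OF that(1)] to_root[OF that(2)] sym_rtrancl[OF sym]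
    by (meson rtrancl_trans symD)
  then have con: "connected_by G ?T" using r by (auto simp: connected_by_def)
  have "?T \<subseteq> edges G" using pe by (simp add: image_subset_iff)
  have "\<not> cycle_in G ?T vs es" for vs es
  proof
    assume cyc: "cycle_in G ?T vs es"
    define N where "N = length es"
    have N: "N > 0" "length vs = N" "distinct es"
      and T: "\<And>i. i < N \<Longrightarrow> es ! i \<in> ?T"
      and ends: "\<And>i. i < N \<Longrightarrow> ends G (es ! i) = {vs ! i, vs ! (Suc i mod N)}"
      using cyc by (auto simp: cycle_in_def N_def)
    have "finite ((\<lambda>i. \<rho> (vs ! i)) ` {..<N})" "(\<lambda>i. \<rho> (vs ! i)) ` {..<N} \<noteq> {}" using N by auto
    then obtain m where m: "m < N" and "\<rho> (vs ! m) = Max ((\<lambda>i. \<rho> (vs ! i)) ` {..<N})"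
      using Max_in by (metis (no_types, lifting) imageE lessThan_iff)
    then have max: "\<rho> (vs ! i) \<le> \<rho> (vs ! m)" if "i < N" for i
      using that by simp
    have top: "es ! i = pe (vs ! m)" if i: "i < N" and mem: "vs ! m \<in> ends G (es ! i)" for i
    proof -
      obtain v where v: "v \<in> verts G - {r}" "es ! i = pe v" using T[OF i] by auto
      have "v \<in> {vs ! i, vs ! (Suc i mod N)}" using ends[OF i] v pe[OF v(1)] by auto
      moreover have "Suc i mod N < N" using N by simp
      ultimately have "\<rho> v \<le> \<rho> (vs ! m)" using max i by auto
      then have "vs ! m \<noteq> par v" using pe[OF v(1)] by auto
      then show ?thesis using mem v pe[OF v(1)] by auto
    qed
    \<comment> \<open>The cyclic predecessor of \<open>m\<close>: the edges at \<open>?p\<close> and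
      \<open>m\<close> both meet \<open>vs ! m\<close>. If they coincide, the cycle has length 1 and
      its edge would be a loop.\<close>
    let ?p = "(m + N - 1) mod N"
    have p: "?p < N" "Suc ?p mod N = m"
      using N m by (auto simp: mod_Suc_eq)
    have "es ! m = es ! ?p"
      using top[OF m] top[OF p(1)] ends[OF m] ends[OF p(1)] p(2) by simp
    then have "?p = m" using N p m by (simp add: N_def nth_eq_iff_index_eq)
    then have "ends G (es ! m) = {vs ! m}" using ends[OF m] p by simp
    moreover obtain v where v: "v \<in> verts G - {r}" "es ! m = pe v" using T[OF m] by auto
    then have "es ! m \<in> edges G" using pe[OF v(1)] by simp
    then have "card (ends G (es ! m)) = 2" using wf by (simp add: wf_multigraph_def)
    ultimately show False by simp
  qed
  then show "spanning_tree G ?T"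
    unfolding spanning_tree_def using con \<open>?T \<subseteq> edges G\<close> by blast
qed

section \<open>Summation by layers\<close>

lemma sum_comp_eq_sum_layers:
  fixes q :: "nat \<Rightarrow> nat"
  assumes "finite A" "h ` A \<subseteq> {..N}" "q 0 = 0" "\<And>t. t < N \<Longrightarrow> q t \<le> q (Suc t)"
  shows "(\<Sum>a\<in>A. q (h a)) = (\<Sum>t<N. (q (Suc t) - q t) * card {a \<in> A. t < h a})"
proof -
  have layer: "q s = (\<Sum>t<N. if t < s then q (Suc t) - q t else 0)" if "s \<le> N" for s
  proof -
    have "q s = (\<Sum>t<s. q (Suc t) - q t)" using that
    proof (induction s)
      case (Suc s)
      then show ?case using assms(4)[of s] by simp
    qed (simp add: assms(3))
    also have "\<dots> = (\<Sum>t<N. if t < s then q (Suc t) - q t else 0)"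
      using that by (intro sum.mono_neutral_cong_left) auto
    finally show ?thesis .
  qed
  have "(\<Sum>a\<in>A. q (h a)) = (\<Sum>a\<in>A. \<Sum>t<N. if t < h a then q (Suc t) - q t else 0)"
    using assms(2) by (intro sum.cong[OF refl] layer) auto
  also have "\<dots> = (\<Sum>t<N. \<Sum>a\<in>A. if t < h a then q (Suc t) - q t else 0)"
    by (rule sum.swap)
  also have "\<dots> = (\<Sum>t<N. (q (Suc t) - q t) * card {a \<in> A. t < h a})"
    by (intro sum.cong refl) (simp add: sum.inter_filter[OF assms(1), symmetric])
  finally show ?thesis .
qed

text \<open>In the expansion by increments of \<open>q\<close>, the increment at \<open>t\<close>
  counts \<open>N - t\<close> times on the left and once for each \<open>a\<close> with
  \<open>t < h a\<close> on the right. With least loads as \<open>q\<close> and the site of a tree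
  edge as \<open>h\<close>, this bounds the weight of every spanning tree from below.\<close>

lemma sum_le_sum_comp:
  fixes q :: "nat \<Rightarrow> nat"
  assumes "finite A" "h ` A \<subseteq> {..N}" "q 0 = 0" "\<And>t. t < N \<Longrightarrow> q t \<le> q (Suc t)"
    and "\<And>t. t < N \<Longrightarrow> N - t \<le> card {a \<in> A. t < h a}"
  shows "(\<Sum>t=1..N. q t) \<le> (\<Sum>a\<in>A. q (h a))"
proof -
  have "{a \<in> {1..N}. t < a} = {Suc t..N}" for t by auto
  then have "(\<Sum>t=1..N. q t) = (\<Sum>t<N. (q (Suc t) - q t) * (N - t))"
    using sum_comp_eq_sum_layers[of "{1..N}" "\<lambda>t. t" N q] assms by (simp add: image_subset_iff)
  also have "\<dots> \<le> (\<Sum>t<N. (q (Suc t) - q t) * card {a \<in> A. t < h a})"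
    using assms(5) by (intro sum_mono mult_left_mono) auto
  also have "\<dots> = (\<Sum>a\<in>A. q (h a))"
    using sum_comp_eq_sum_layers[OF assms(1-4)] by simp
  finally show ?thesis .
qed

section \<open>The greedy process on the fan\<close>

text \<open>The base edge \<open>2 * t\<close> is the rim edge \<open>{t - 1, t}\<close>, and \<open>2 * t + 1\<close> is the spoke \<open>{0, t}\<close>;
  together they form site \<open>t\<close>. The last site \<open>n + 1\<close> has no spoke.\<close>

definition site :: "nat \<Rightarrow> nat" where
  "site b = b div 2"

definition base_ends :: "nat \<Rightarrow> nat set" where
  "base_ends b = {if even b then site b - 1 else 0, site b}"

text \<open>Sites \<open>t\<close> and \<open>t + 1\<close> are tied if their four edges have equal loads. Then vertex \<open>t\<close> is
  attached upwards, to \<open>t + 1\<close>, which moves one edge of the tree across the boundary.\<close>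

definition tied :: "nat \<Rightarrow> (nat \<Rightarrow> nat) \<Rightarrow> nat \<Rightarrow> bool" where
  "tied n L t \<longleftrightarrow> 1 \<le> t \<and> t < n \<and> L (2 * t + 1) = L (2 * t) \<and> L (2 * t + 2) = L (2 * t)
     \<and> L (2 * t + 3) = L (2 * t)"

text \<open>The first edge on the tree path from \<open>t\<close> to the hub. If
  \<open>t - 1\<close> climbs along the rim \<open>2 * t\<close>, that rim is no longer free for
  \<open>t\<close>, which explains the second case.\<close>

definition parent_edge :: "nat \<Rightarrow> (nat \<Rightarrow> nat) \<Rightarrow> nat \<Rightarrow> nat" where
  "parent_edge n L t = (if tied n L t then 2 * t + 2 else if tied n L (t - 1) then 2 * t + 1
     else if t = n + 1 \<or> L (2 * t) \<le> L (2 * t + 1) then 2 * t else 2 * t + 1)"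

definition base_tree :: "nat \<Rightarrow> (nat \<Rightarrow> nat) \<Rightarrow> nat set" where
  "base_tree n L = parent_edge n L ` {1..n + 1}"

fun load :: "nat \<Rightarrow> nat \<Rightarrow> nat \<Rightarrow> nat" where
  "load n 0 = (\<lambda>b. 0)"
| "load n (Suc i) = (\<lambda>b. load n i b + of_bool (b \<in> base_tree n (load n i)))"

definition site_load :: "nat \<Rightarrow> nat \<Rightarrow> nat \<Rightarrow> nat" where
  "site_load n i t = load n i (2 * t) + load n i (2 * t + 1)"

abbreviation tied_at :: "nat \<Rightarrow> nat \<Rightarrow> nat \<Rightarrow> bool" where
  "tied_at n i \<equiv> tied n (load n i)"

section \<open>Site loads under the tie-breaking rule\<close>

lemma rim_in_base_tree_iff:
  assumes "1 \<le> t" "t \<le> n"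
  shows "2 * t \<in> base_tree n L \<longleftrightarrow> tied n L (t - 1) \<or> \<not> tied n L t \<and> L (2 * t) \<le> L (2 * t + 1)"
    (is "?l \<longleftrightarrow> ?r")
proof
  assume ?l
  then obtain s where "s \<in> {1..n+1}" "2 * t = parent_edge n L s" by (auto simp: base_tree_def)
  moreover have [simp]: "2 * t = Suc (Suc (2 * s)) \<longleftrightarrow> t = Suc s" "2 * t \<noteq> Suc (2 * s)" for s
    by presburger+
  ultimately show ?r using assms
    by (auto simp: parent_edge_def split: if_splits)
next
  assume r: ?r
  show ?l
  proof (cases "tied n L (t - 1)")
    case True
    then have "t - 1 \<in> {1..n+1}" "parent_edge n L (t - 1) = 2 * t"
      using assms by (auto simp: tied_def parent_edge_def)
    then show ?thesis unfolding base_tree_def by (metis imageI)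
  next
    case False
    then have "t \<in> {1..n+1}" "parent_edge n L t = 2 * t"
      using assms r by (auto simp: parent_edge_def)
    then show ?thesis unfolding base_tree_def by (metis imageI)
  qed
qed

lemma spoke_in_base_tree_iff:
  assumes "1 \<le> t" "t \<le> n"
  shows "2 * t + 1 \<in> base_tree n L \<longleftrightarrow> \<not> tied n L t \<and> (tied n L (t - 1) \<or> L (2 * t + 1) < L (2 * t))"
    (is "?l \<longleftrightarrow> ?r")
proof
  assume ?l
  then obtain s where "s \<in> {1..n+1}" "2 * t + 1 = parent_edge n L s" by (auto simp: base_tree_def)
  moreover have [simp]: "2 * t \<noteq> Suc (2 * s)" "Suc (2 * t) \<noteq> 2 * s" for s by presburger+
  ultimately show ?r using assms
    by (auto simp: parent_edge_def split: if_splits)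
next
  assume r: ?r
  then have "t \<in> {1..n+1}" "parent_edge n L t = 2 * t + 1"
    using assms by (auto simp: parent_edge_def)
  then show ?l unfolding base_tree_def by (metis imageI)
qed

lemma bridge_in_base_tree: "2 * n + 2 \<in> base_tree n L"
proof -
  have "parent_edge n L (n + 1) = 2 * n + 2" by (auto simp: parent_edge_def tied_def)
  then show ?thesis unfolding base_tree_def by (metis atLeastAtMost_iff imageI le_add2 order_refl)
qed

lemma load_eq_card: "load n i b = card {m. m < i \<and> b \<in> base_tree n (load n m)}"
proof (induction i)
  case (Suc i)
  have "{m. m < Suc i \<and> b \<in> base_tree n (load n m)} = {m. m < i \<and> b \<in> base_tree n (load n m)}
    \<union> (if b \<in> base_tree n (load n i) then {i} else {})"
    by (auto simp: less_Suc_eq)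
  with Suc show ?case by auto
qed simp

lemma load_le: "load n i b \<le> i"
  by (induction i) (auto simp: of_bool_def)

lemma load_bridge: "load n i (2 * n + 2) = i"
  by (induction i) (use bridge_in_base_tree in auto)

lemma site_load_Suc:
  assumes "1 \<le> t" "t \<le> n"
  shows "site_load n (Suc i) t + of_bool (tied_at n i t)
    = site_load n i t + 1 + of_bool (tied_at n i (t - 1))"
  using rim_in_base_tree_iff[OF assms, of "load n i"] spoke_in_base_tree_iff[OF assms, of "load n i"]
  by (cases "tied_at n i t"; cases "tied_at n i (t - 1)") (simp_all add: site_load_def not_le)

text \<open>Two numbers that differ by at most 1 are equal exactly when their sum is even. This
  allows ties to be read off the site loads alone.\<close>

lemma all_equal_iff_sums_even:
  fixes a b c d :: nat
  assumes "a \<le> b + 1 \<and> b \<le> a + 1" "c \<le> d + 1 \<and> d \<le> c + 1"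
  shows "b = a \<and> c = a \<and> d = a \<longleftrightarrow> a + b = c + d \<and> even (a + b)"
proof -
  have "b = a" if "even (a + b)" using that assms(1) by presburger
  moreover have "d = c" if "even (c + d)" using that assms(2) by presburger
  ultimately have "a + b = c + d \<Longrightarrow> even (a + b) \<Longrightarrow> b = a \<and> d = c" by simp
  moreover have "b = a \<Longrightarrow> d = c \<Longrightarrow> a + b = c + d \<longleftrightarrow> c = a" by auto
  moreover have "b = a \<Longrightarrow> even (a + b)" by simp
  ultimately show ?thesis by blast
qed

text \<open>Here \<open>f\<close>, \<open>g\<close>, \<open>h\<close> are the moves below, between
  and above two neighbouring sites of loads \<open>x\<close> and \<open>y\<close>. Equal even loads
  are separated by \<open>g\<close>, and equal odd loads block all moves. At a gap of 1 one load is
  odd, so either no edge enters the lower site or none leaves the upper one.\<close>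

lemma flux_step_mono:
  fixes x y x' y' :: nat
  assumes "x' + of_bool g = x + 1 + of_bool f" "y' + of_bool h = y + 1 + of_bool g"
    and "x \<le> y" "g \<longleftrightarrow> x = y \<and> even x" "f \<Longrightarrow> even x" "h \<Longrightarrow> even y"
  shows "x' \<le> y'"
proof -
  consider "x = y" | "y = Suc x" | "x + 2 \<le> y" using assms(3) by linarith
  then show ?thesis
  proof cases
    case 1
    then show ?thesis using assms by (cases f; cases g; cases h) simp_all
  next
    case 2
    then have "\<not> g" "\<not> f \<or> \<not> h" using assms(4-6) by auto
    then show ?thesis using 2 assms(1,2) by (cases f; cases h) simp_all
  next
    case 3
    then have "\<not> g" using assms(4) by simp
    then show ?thesis using 3 assms(1,2) by (cases f; cases h) simp_all
  qed
qed

text \<open>One induction serves both claims, since monotonicity reads ties off the site loads by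
  means of balance. Balance persists because a site touched by a tie has equal edge loads, while any
  other site receives just a lighter edge.\<close>

lemma load_invariant:
  shows balanced: "\<And>t. 1 \<le> t \<Longrightarrow> t \<le> n \<Longrightarrow>
      load n i (2 * t) \<le> load n i (2 * t + 1) + 1 \<and> load n i (2 * t + 1) \<le> load n i (2 * t) + 1"
    and site_load_mono: "\<And>t. 1 \<le> t \<Longrightarrow> t < n \<Longrightarrow> site_load n i t \<le> site_load n i (Suc t)"
proof (induction i)
  case (Suc i)
  note bal = Suc.IH(1) and mono = Suc.IH(2)
  have tied_eq: "load n i (2 * t) = load n i (2 * t + 1)" if "tied_at n i t \<or> tied_at n i (t - 1)" for t
    using that by (cases t) (auto simp: tied_def numeral_3_eq_3)
  {
    case (1 t)
    show ?case
    proof (cases "tied_at n i t \<or> tied_at n i (t - 1)")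
      case True
      then show ?thesis using tied_eq[OF True] by (simp add: of_bool_def)
    next
      case False
      then show ?thesis
        using bal[OF 1] rim_in_base_tree_iff[OF 1, of "load n i"]
          spoke_in_base_tree_iff[OF 1, of "load n i"]
        by (cases "load n i (2 * t) \<le> load n i (2 * t + 1)") simp_all
    qed
  next
    case (2 t)
    have t: "1 \<le> t" "t \<le> n" "1 \<le> Suc t" "Suc t \<le> n" using 2 by auto
    have tied_iff: "tied_at n i t \<longleftrightarrow> site_load n i t = site_load n i (Suc t) \<and> even (site_load n i t)"
      using all_equal_iff_sums_even[OF bal[OF t(1,2)] bal[OF t(3,4)]] 2
      by (simp add: tied_def site_load_def numeral_3_eq_3)
    have ev: "even (site_load n i s)" if "tied_at n i s \<or> tied_at n i (s - 1)" for s
      using tied_eq[OF that] by (simp add: site_load_def)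
    have "site_load n (Suc i) (Suc t) + of_bool (tied_at n i (Suc t))
      = site_load n i (Suc t) + 1 + of_bool (tied_at n i t)"
      using site_load_Suc[OF t(3,4)] by simp
    from flux_step_mono[OF site_load_Suc[OF t(1,2)] this mono[OF 2] tied_iff ev[OF disjI2] ev[OF disjI1]]
    show ?case by blast
  }
qed (auto simp: site_load_def)

section \<open>Flux across the site boundaries\<close>

definition flux :: "nat \<Rightarrow> nat \<Rightarrow> nat \<Rightarrow> nat" where
  "flux n i t = (\<Sum>m<i. of_bool (tied_at n m t))"

lemma flux_mono: "i \<le> i' \<Longrightarrow> flux n i t \<le> flux n i' t"
  unfolding flux_def by (rule sum_mono2) auto

text \<open>Conservation: each step gives every site one edge, and a tie at \<open>s\<close> passes
  one from \<open>s\<close> to \<open>s + 1\<close>. Inside the prefix these moves cancel, and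
  nothing enters at boundary 0, which is never tied.\<close>

lemma sum_site_load_flux: "t \<le> n \<Longrightarrow> (\<Sum>s=1..t. site_load n i s) + flux n i t = i * t"
proof (induction i)
  case 0
  then show ?case by (simp add: site_load_def flux_def)
next
  case (Suc i)
  have "(\<Sum>s=1..t. site_load n (Suc i) s) + of_bool (tied_at n i t)
    = (\<Sum>s=1..t. site_load n i s) + t"
    using Suc.prems
  proof (induction t)
    case 0
    then show ?case by (simp add: tied_def)
  next
    case (Suc t)
    then show ?case using site_load_Suc[of "Suc t" n i] by simp
  qed
  moreover have "flux n (Suc i) t = flux n i t + of_bool (tied_at n i t)"
    by (simp add: flux_def)
  ultimately show ?case using Suc by simp
qed

lemma site_load_le_site_load:
  assumes "1 \<le> s" "s \<le> t" "t \<le> n"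
  shows "site_load n i s \<le> site_load n i t"
  using assms(2,3)
proof (induction t rule: dec_induct)
  case (step t)
  then show ?case using site_load_mono[of t n i] assms(1) by simp
qed simp

lemma tied_at_iff:
  assumes "1 \<le> t" "t < n"
  shows "tied_at n i t \<longleftrightarrow> site_load n i t = site_load n i (Suc t) \<and> even (site_load n i t)"
  using all_equal_iff_sums_even[OF balanced[of t n i] balanced[of "Suc t" n i]] assms
  by (simp add: tied_def site_load_def numeral_3_eq_3)

text \<open>Two sites of equal odd load become tied after one more tree, since each of them then
  gets exactly one edge.\<close>

lemma tied_soon:
  assumes "1 \<le> t" "t < n" "site_load n i t = site_load n i (Suc t)"
  shows "tied_at n i t \<or> tied_at n (Suc i) t"
proof (cases "even (site_load n i t)")
  case True
  then show ?thesis using tied_at_iff assms by simp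
next
  case False
  have ev: "even (site_load n i s)" if "tied_at n i s \<or> tied_at n i (s - 1)" for s
    using that by (cases s) (auto simp: tied_def site_load_def numeral_3_eq_3)
  have "\<not> tied_at n i t" "\<not> tied_at n i (t - 1)" "\<not> tied_at n i (Suc t)"
    using ev[of t] ev[of "Suc t"] False assms(3) by auto
  then have "site_load n (Suc i) t = Suc (site_load n i t)"
    "site_load n (Suc i) (Suc t) = Suc (site_load n i t)"
    using site_load_Suc[of t n i] site_load_Suc[of "Suc t" n i] assms by simp_all
  then show ?thesis using tied_at_iff[OF assms(1,2), of "Suc i"] False by simp
qed

text \<open>Each strict increase adds at least 1. For site loads of small range this leaves many
  pairs of equal neighbours.\<close>

lemma card_increases_le:
  fixes f :: "nat \<Rightarrow> nat"
  assumes "1 \<le> N" "\<And>t. 1 \<le> t \<Longrightarrow> t < N \<Longrightarrow> f t \<le> f (Suc t)"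
  shows "card {t \<in> {1..<N}. f t \<noteq> f (Suc t)} + f 1 \<le> f N"
  using assms
proof (induction N rule: dec_induct)
  case base
  then show ?case by simp
next
  case (step N)
  have "{t \<in> {1..<Suc N}. f t \<noteq> f (Suc t)}
    = {t \<in> {1..<N}. f t \<noteq> f (Suc t)} \<union> (if f N \<noteq> f (Suc N) then {N} else {})"
    using step.hyps by (auto simp: less_Suc_eq)
  moreover have "f N \<le> f (Suc N)" using step by simp
  moreover have "card {t \<in> {1..<N}. f t \<noteq> f (Suc t)} + f 1 \<le> f N" using step by simp
  ultimately show ?case by (auto split: if_splits)
qed

text \<open>While the deficit at site 1 is small, the loads of the first \<open>4 * j\<close> sites span a
  range shorter than \<open>2 * j\<close>, so at least \<open>2 * j\<close> of the boundaries between them carry flux in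
  every two steps. A small deficit also bounds the total flux, hence the number of steps.\<close>

lemma flux_first_lower:
  assumes j: "1 \<le> j" "8 * j \<le> n" and small: "flux n i 1 < j"
  shows "i < 18 * j\<^sup>2"
proof -
  \<comment> \<open>Site 1 lags behind \<open>m\<close> by exactly \<open>flux n m 1\<close>, and by
    monotonicity no site lags more.\<close>
  have site: "m < site_load n m s + j" if "m \<le> i" "1 \<le> s" "s \<le> n" for m s
  proof -
    have "site_load n m 1 + flux n m 1 = m" using sum_site_load_flux[of 1 n m] j by simp
    then show ?thesis
      using flux_mono[OF that(1), of n 1] small site_load_le_site_load[of 1 s n m] that by simp
  qed
  have flux_le: "flux n m t \<le> j * t" if "m \<le> i" "t \<le> n" for m t
  proof -
    have "m * t = (\<Sum>s=1..t. m)" by simp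
    also have "\<dots> \<le> (\<Sum>s=1..t. site_load n m s + j)"
      using site[OF that(1)] that(2) by (intro sum_mono) (simp add: less_imp_le)
    also have "\<dots> = (\<Sum>s=1..t. site_load n m s) + j * t" by (simp add: sum.distrib)
    finally show ?thesis using sum_site_load_flux[OF that(2), of m] by simp
  qed
  \<comment> \<open>Otherwise the next \<open>4 * j\<close> sites each exceed \<open>m\<close> by at
    least \<open>j\<close>, while each of the first \<open>4 * j\<close> lags by less than
    \<open>j\<close>. The first \<open>8 * j\<close> sites would then hold more than
    \<open>m * (8 * j)\<close> edges.\<close>
  have top: "site_load n m (4 * j) < m + j" if "m \<le> i" for m
  proof (rule ccontr)
    assume "\<not> ?thesis"
    then have high: "m + j \<le> site_load n m s" if "s \<in> {4 * j + 1..8 * j}" for s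
      using site_load_le_site_load[of "4 * j" s n m] that j by simp
    have "4 * j * (m + 1) = (\<Sum>s=1..4*j. m + 1)" by simp
    also have "\<dots> \<le> (\<Sum>s=1..4*j. site_load n m s + j)"
      using site[OF that] j by (intro sum_mono) (simp add: Suc_le_eq)
    also have "\<dots> = (\<Sum>s=1..4*j. site_load n m s) + 4 * j * j" by (simp add: sum.distrib)
    finally have low: "4 * j * (m + 1) \<le> (\<Sum>s=1..4*j. site_load n m s) + 4 * j * j" .
    have "4 * j * (m + j) = (\<Sum>s=4*j+1..4*j+4*j. m + j)" by simp
    also have "\<dots> \<le> (\<Sum>s=4*j+1..4*j+4*j. site_load n m s)"
      using high by (intro sum_mono) simp
    finally have "4 * j * (m + 1) + 4 * j * (m + j) \<le> (\<Sum>s=1..4*j+4*j. site_load n m s) + 4 * j * j"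
      using low by (simp only: sum.ub_add_nat[of 1 "4*j" "site_load n m" "4*j"])
    also have "\<dots> \<le> m * (8 * j) + 4 * j * j"
      using sum_site_load_flux[OF j(2), of m] by simp
    finally show False using j(1) by (simp add: algebra_simps)
  qed
  have tied_many: "2 * j \<le> (\<Sum>t\<in>{1..<4*j}. of_bool (tied_at n m t) + of_bool (tied_at n (Suc m) t))"
    if m: "m \<le> i" for m
  proof -
    let ?N = "{t \<in> {1..<4*j}. site_load n m t \<noteq> site_load n m (Suc t)}"
    let ?E = "{t \<in> {1..<4*j}. site_load n m t = site_load n m (Suc t)}"
    have "card ?N + site_load n m 1 \<le> site_load n m (4 * j)"
      using j by (intro card_increases_le site_load_mono) auto
    \<comment> \<open>Site 1 has load above \<open>m - j\<close> and site \<open>4 * j\<close> has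
      load below \<open>m + j\<close>, so the range is at most \<open>2 * j - 2\<close>.\<close>
    then have N: "card ?N + 2 \<le> 2 * j" using top[OF m] site[OF m, of 1] j by simp
    have "card ?N + card ?E = card (?N \<union> ?E)" by (rule card_Un_disjoint[symmetric]) auto
    also have "?N \<union> ?E = {1..<4*j}" by blast
    finally have "card ?N + card ?E + 1 = 4 * j" using j by simp
    with N have "2 * j \<le> card ?E" by simp
    also have "\<dots> = (\<Sum>t\<in>?E. 1)" by simp
    also have "\<dots> \<le> (\<Sum>t\<in>?E. of_bool (tied_at n m t) + of_bool (tied_at n (Suc m) t))"
    proof (rule sum_mono)
      fix t assume "t \<in> ?E"
      then have "tied_at n m t \<or> tied_at n (Suc m) t" using j by (intro tied_soon) auto
      then show "1 \<le> (of_bool (tied_at n m t) + of_bool (tied_at n (Suc m) t) :: nat)"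
        by (auto simp: of_bool_def)
    qed
    also have "\<dots> \<le> (\<Sum>t\<in>{1..<4*j}. of_bool (tied_at n m t) + of_bool (tied_at n (Suc m) t))"
      by (rule sum_mono2) auto
    finally show ?thesis .
  qed
  \<comment> \<open>Steps are taken in pairs, since equal neighbours are certain to be tied only in
    one of two consecutive steps.\<close>
  have total: "2 * j * m \<le> (\<Sum>t\<in>{1..<4*j}. flux n (2 * m) t)" if "2 * m \<le> i" for m
    using that
  proof (induction m)
    case (Suc m)
    have "flux n (2 * Suc m) t = flux n (2 * m) t
        + (of_bool (tied_at n (2 * m) t) + of_bool (tied_at n (Suc (2 * m)) t))" for t
      by (simp add: flux_def)
    then have "(\<Sum>t\<in>{1..<4*j}. flux n (2 * Suc m) t) = (\<Sum>t\<in>{1..<4*j}. flux n (2 * m) t)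
        + (\<Sum>t\<in>{1..<4*j}. of_bool (tied_at n (2 * m) t) + of_bool (tied_at n (Suc (2 * m)) t))"
      by (simp only: sum.distrib)
    then show ?case using Suc tied_many[of "2 * m"] by simp
  qed simp
  define m where "m = i div 2"
  have m: "2 * m \<le> i" "i \<le> 2 * m + 1" by (auto simp: m_def)
  have "2 * j * m \<le> (\<Sum>t\<in>{1..<4*j}. flux n (2 * m) t)" by (rule total[OF m(1)])
  also have "\<dots> \<le> (\<Sum>t\<in>{1..<4*j}. j * (4 * j))"
  proof (rule sum_mono)
    fix t assume "t \<in> {1..<4*j}"
    then have "flux n (2 * m) t \<le> j * t" "j * t \<le> j * (4 * j)"
      using flux_le[OF m(1), of t] j by auto
    then show "flux n (2 * m) t \<le> j * (4 * j)" by (rule le_trans)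
  qed
  also have "\<dots> \<le> 4 * j * (j * (4 * j))" by (simp add: mult_le_mono1)
  finally have "(2 * j) * m \<le> (2 * j) * (8 * j\<^sup>2)" by (simp add: power2_eq_square)
  then have "m \<le> 8 * j\<^sup>2" using j by simp
  \<comment> \<open>Now \<open>i\<close> is at most \<open>2 * m + 1\<close>, hence at most
    \<open>16 * j\<^sup>2 + 1\<close>; the constant 18 absorbs the 1.\<close>
  moreover have "1 \<le> j\<^sup>2" using j by simp
  ultimately show ?thesis using m by linarith
qed

text \<open>With \<open>a\<close> the deficit, the previous bound applies to
  \<open>a + 1 \<le> 2 * a\<close>, whence \<open>72 = 18 * 4\<close>. If the fan is too short for
  it, then \<open>n \<le> 16 * a\<close> and the bound follows from
  \<open>4 * i \<le> n\<^sup>2\<close>.\<close>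

lemma deficit_lower:
  assumes "2 \<le> n" "1 \<le> i" "4 * i \<le> n\<^sup>2"
  shows "i \<le> 72 * (flux n i 1)\<^sup>2"
proof -
  define a where "a = flux n i 1"
  \<comment> \<open>All loads start at 0, so the first step already moves an edge out of site
    1.\<close>
  have "tied_at n 0 1" using assms by (simp add: tied_def)
  then have "flux n 1 1 = 1" by (simp add: flux_def)
  then have a: "1 \<le> a" using flux_mono[OF assms(2), of n 1] by (simp add: a_def)
  have "i \<le> 72 * a\<^sup>2"
  proof (cases "8 * (a + 1) \<le> n")
    case True
    then have "i < 18 * (a + 1)\<^sup>2" by (intro flux_first_lower) (auto simp: a_def)
    also have "\<dots> \<le> 18 * (2 * a)\<^sup>2" using a by (intro mult_left_mono power_mono) auto
    finally show ?thesis by (simp add: power2_eq_square)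
  next
    case False
    then have "n \<le> 16 * a" using a by simp
    then have "n\<^sup>2 \<le> (16 * a)\<^sup>2" by (intro power_mono) auto
    then show ?thesis using assms(3) by (simp add: power2_eq_square)
  qed
  then show ?thesis by (simp add: a_def)
qed

section \<open>The multigraph and its packing\<close>

text \<open>Every base edge \<open>b\<close> gets the \<open>l\<close> parallel copies \<open>b * l + c\<close> for \<open>c < l\<close>.\<close>

definition fan :: "nat \<Rightarrow> nat \<Rightarrow> (nat, nat) multigraph" where
  "fan n l = \<lparr>verts = {..n + 1}, edges = {2 * l..<(2 * n + 3) * l}, ends = (\<lambda>e. base_ends (e div l))\<rparr>"

definition copies :: "nat \<Rightarrow> nat \<Rightarrow> nat set \<Rightarrow> nat set" where
  "copies l c B = (\<lambda>b. b * l + c) ` B"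

text \<open>In a round of \<open>l\<close> trees, each tree uses copies that are still unused in that round, so the
  least load among the copies of a base edge remains equal to its base load.\<close>

definition packing :: "nat \<Rightarrow> nat \<Rightarrow> nat \<Rightarrow> nat set" where
  "packing n l j = copies l ((j - 1) mod l) (base_tree n (load n ((j - 1) div l)))"

lemma in_copies_iff: "c < l \<Longrightarrow> e \<in> copies l c B \<longleftrightarrow> e div l \<in> B \<and> e mod l = c"
  by (force simp: copies_def image_iff)

lemma verts_fan [simp]: "verts (fan n l) = {..n + 1}"
  and ends_fan [simp]: "ends (fan n l) e = base_ends (e div l)"
  by (simp_all add: fan_def)

lemma in_edges_fan_iff: "1 \<le> l \<Longrightarrow> e \<in> edges (fan n l) \<longleftrightarrow> 2 \<le> e div l \<and> e div l < 2 * n + 3"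
  by (auto simp: fan_def less_eq_div_iff_mult_less_eq div_less_iff_less_mult)

lemma base_ends_properties:
  assumes "2 \<le> b" "b < 2 * n + 3"
  shows "base_ends b \<subseteq> {..site b}" "site b \<le> n + 1" "card (base_ends b) = 2"
proof -
  show "site b \<le> n + 1" using assms by (auto simp: site_def)
  moreover have "1 \<le> site b" using assms by (auto simp: site_def)
  ultimately show "base_ends b \<subseteq> {..site b}" "card (base_ends b) = 2" by (auto simp: base_ends_def)
qed

lemma wf_fan: "1 \<le> l \<Longrightarrow> wf_multigraph (fan n l)"
proof -
  assume l: "1 \<le> l"
  have "ends (fan n l) e \<subseteq> verts (fan n l) \<and> card (ends (fan n l) e) = 2" if "e \<in> edges (fan n l)" for e
    using that base_ends_properties[of "e div l" n] by (force simp: in_edges_fan_iff[OF l])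
  then show ?thesis by (simp add: wf_multigraph_def) (simp add: fan_def)
qed

text \<open>No edge reaches a vertex above its site, so an edge that leaves \<open>{..t}\<close> has
  a site beyond \<open>t\<close>. This count serves the tree weights, the cut at the bridge and the
  ideal loads.\<close>

lemma card_later_edges_ge:
  assumes "1 \<le> l" "F \<subseteq> edges (fan n l)" "connected_by (fan n l) F" "t \<le> n + 1"
  shows "n + 1 - t \<le> card {e \<in> F. t < site (e div l)}"
proof -
  have fin: "finite F" using assms(1,2) wf_fan by (auto simp: wf_multigraph_def intro: finite_subset)
  have "{..n + 1} - {..t} = {t + 1..n + 1}" by auto
  then have "n + 1 - t = card (verts (fan n l) - {..t})" by simp
  also have "\<dots> \<le> card {e \<in> F. \<not> ends (fan n l) e \<subseteq> {..t}}"
    using assms wf_fan by (intro card_edges_leaving_ge) auto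
  also have "\<dots> \<le> card {e \<in> F. t < site (e div l)}"
  proof (rule card_mono)
    show "{e \<in> F. \<not> ends (fan n l) e \<subseteq> {..t}} \<subseteq> {e \<in> F. t < site (e div l)}"
    proof safe
      fix e x assume e: "e \<in> F" and x: "x \<in> ends (fan n l) e" "\<not> x \<le> t"
      have "x \<le> site (e div l)"
        using e x assms(2) base_ends_properties(1)[of "e div l" n] in_edges_fan_iff[OF assms(1)] by auto
      with x show "t < site (e div l)" by simp
    qed
  qed (use fin in simp)
  finally show ?thesis .
qed

lemma
  fixes h :: "nat \<Rightarrow> nat"
  assumes l: "1 \<le> l" "c < l"
    and h: "\<And>t. 1 \<le> t \<Longrightarrow> t \<le> n + 1 \<Longrightarrow> 2 \<le> h t \<and> h t < 2 * n + 3 \<and> base_ends (h t) = {t, par t}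
      \<and> par t \<le> n + 1 \<and> \<rho> (par t) < (\<rho> t :: nat)"
  shows spanning_tree_copies: "spanning_tree (fan n l) (copies l c (h ` {1..n + 1}))"
    and inj_on_copies: "inj_on (\<lambda>t. h t * l + c) {1..n + 1}"
proof -
  have verts: "verts (fan n l) - {0} = {1..n + 1}" by auto
  have div: "(h t * l + c) div l = h t" for t using l by simp
  have *: "h t * l + c \<in> edges (fan n l) \<and> ends (fan n l) (h t * l + c) = {t, par t}
      \<and> par t \<in> verts (fan n l) \<and> \<rho> (par t) < \<rho> t" if "t \<in> verts (fan n l) - {0}" for t
    using that h[of t] unfolding verts in_edges_fan_iff[OF l(1)] ends_fan div by simp
  show "spanning_tree (fan n l) (copies l c (h ` {1..n + 1}))"
    using spanning_tree_parent_edges[where r = 0, OF wf_fan[OF l(1)] _ *] unfolding verts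
    by (simp add: copies_def image_image)
  show "inj_on (\<lambda>t. h t * l + c) {1..n + 1}"
    using inj_on_parent_edges[where r = 0, OF wf_fan[OF l(1)] _ *] unfolding verts by simp
qed

lemma base_ends_rim: "base_ends (2 * t) = {t - 1, t}"
  and base_ends_spoke: "base_ends (2 * t + 1) = {0, t}"
  by (auto simp: base_ends_def site_def)

definition parent :: "nat \<Rightarrow> (nat \<Rightarrow> nat) \<Rightarrow> nat \<Rightarrow> nat" where
  "parent n L t = (if tied n L t then t + 1 else if tied n L (t - 1) then 0
     else if t = n + 1 \<or> L (2 * t) \<le> L (2 * t + 1) then t - 1 else 0)"

text \<open>Paths to the hub 0 either climb through tied sites and then take a spoke, or descend.\<close>

definition depth_bound :: "nat \<Rightarrow> (nat \<Rightarrow> nat) \<Rightarrow> nat \<Rightarrow> nat" where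
  "depth_bound n L t = (if t = 0 then 0 else if tied n L t then n + 2 - t
     else if tied n L (t - 1) then 1 else t + 1)"

lemma parent_edge_tree:
  assumes "1 \<le> t" "t \<le> n + 1"
  shows "2 \<le> parent_edge n L t \<and> parent_edge n L t < 2 * n + 3
    \<and> base_ends (parent_edge n L t) = {t, parent n L t} \<and> parent n L t \<le> n + 1
    \<and> depth_bound n L (parent n L t) < depth_bound n L t"
proof -
  have lt: "1 \<le> s" "s < n" if "tied n L s" for s using that by (auto simp: tied_def)
  consider (up) "tied n L t" | (spoke) "\<not> tied n L t" "tied n L (t - 1)"
    | (rim) "\<not> tied n L t" "\<not> tied n L (t - 1)" "t = n + 1 \<or> L (2 * t) \<le> L (2 * t + 1)"
    | (light) "\<not> tied n L t" "\<not> tied n L (t - 1)" "\<not> (t = n + 1 \<or> L (2 * t) \<le> L (2 * t + 1))"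
    by blast
  then show ?thesis
  proof cases
    case up
    then have pe: "parent_edge n L t = 2 * (t + 1)" "parent n L t = t + 1"
      by (simp_all add: parent_edge_def parent_def)
    have "depth_bound n L (t + 1) < depth_bound n L t" using up lt[of t] lt[of "t + 1"] by (auto simp: depth_bound_def)
    then show ?thesis unfolding pe base_ends_rim using lt[OF up] by auto
  next
    case spoke
    then have pe: "parent_edge n L t = 2 * t + 1" "parent n L t = 0"
      by (simp_all add: parent_edge_def parent_def)
    have "depth_bound n L 0 < depth_bound n L t" using spoke assms(1) by (auto simp: depth_bound_def)
    then show ?thesis unfolding pe base_ends_spoke using lt[OF spoke(2)] assms by auto
  next
    case rim
    then have pe: "parent_edge n L t = 2 * t" "parent n L t = t - 1"
      by (auto simp: parent_edge_def parent_def)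
    have "depth_bound n L (t - 1) < depth_bound n L t" using rim(1,2) assms(1) by (auto simp: depth_bound_def)
    then show ?thesis unfolding pe base_ends_rim using assms by auto
  next
    case light
    then have pe: "parent_edge n L t = 2 * t + 1" "parent n L t = 0"
      by (auto simp: parent_edge_def parent_def)
    have "depth_bound n L 0 < depth_bound n L t" using light assms(1) by (auto simp: depth_bound_def)
    then show ?thesis unfolding pe base_ends_spoke using light(3) assms by auto
  qed
qed

lemma
  assumes "c < l"
  shows spanning_tree_base_tree: "spanning_tree (fan n l) (copies l c (base_tree n L))"
    and inj_on_parent_edge: "inj_on (\<lambda>t. parent_edge n L t * l + c) {1..n + 1}"
proof -
  have l: "1 \<le> l" using assms by simp
  note * = parent_edge_tree[of _ n L]
  show "spanning_tree (fan n l) (copies l c (base_tree n L))"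
    unfolding base_tree_def by (rule spanning_tree_copies[OF l assms *])
  show "inj_on (\<lambda>t. parent_edge n L t * l + c) {1..n + 1}"
    by (rule inj_on_copies[OF l assms *])
qed

section \<open>Loads of the parallel copies\<close>

lemma card_packing_conv:
  assumes "1 \<le> l"
  shows "card {i. 1 \<le> i \<and> i < Suc M \<and> e \<in> packing n l i}
    = card {m. m < M \<and> e div l \<in> base_tree n (load n (m div l)) \<and> e mod l = m mod l}"
proof -
  have "{i. 1 \<le> i \<and> i < Suc M \<and> e \<in> packing n l i}
    = Suc ` {m. m < M \<and> e div l \<in> base_tree n (load n (m div l)) \<and> e mod l = m mod l}"
  proof (rule set_eqI)
    fix i
    show "i \<in> {i. 1 \<le> i \<and> i < Suc M \<and> e \<in> packing n l i} \<longleftrightarrow>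
      i \<in> Suc ` {m. m < M \<and> e div l \<in> base_tree n (load n (m div l)) \<and> e mod l = m mod l}"
      using assms by (cases i) (auto simp: packing_def in_copies_iff)
  qed
  then show ?thesis by (simp add: card_image)
qed

text \<open>Copy \<open>e\<close> has one turn per round, at the zero-based time
  \<open>i * l + e mod l\<close>. Complete rounds account for the base load; the current round may
  add one use, but not if the turn of \<open>e\<close> is just due.\<close>

lemma
  assumes l: "1 \<le> l"
  shows load_le_card_packing: "load n (M div l) (e div l) \<le> card {i. 1 \<le> i \<and> i < Suc M \<and> e \<in> packing n l i}"
    and load_eq_card_packing: "e mod l = M mod l \<Longrightarrow>
      card {i. 1 \<le> i \<and> i < Suc M \<and> e \<in> packing n l i} = load n (M div l) (e div l)"
proof -
  let ?A = "{i. i < M div l \<and> e div l \<in> base_tree n (load n i)}"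
  let ?B = "{m. m < M \<and> e div l \<in> base_tree n (load n (m div l)) \<and> e mod l = m mod l}"
  let ?f = "\<lambda>i. i * l + e mod l"
  have "inj_on ?f ?A" using l by (auto simp: inj_on_def)
  then have card: "card (?f ` ?A) = load n (M div l) (e div l)"
    by (simp add: card_image load_eq_card)
  have sub: "?f ` ?A \<subseteq> ?B"
  proof (rule image_subsetI)
    fix i assume i: "i \<in> ?A"
    have "Suc i * l \<le> M div l * l" using i by (intro mult_le_mono1) simp
    also have "\<dots> \<le> M" by (simp add: div_times_less_eq_dividend)
    finally have "Suc i * l \<le> M" .
    moreover have "e mod l < l" using l by simp
    ultimately have "?f i < M" by simp
    then show "?f i \<in> ?B" using i l by simp
  qed
  then have "card (?f ` ?A) \<le> card ?B" by (intro card_mono) simp_all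
  then show "load n (M div l) (e div l) \<le> card {i. 1 \<le> i \<and> i < Suc M \<and> e \<in> packing n l i}"
    unfolding card_packing_conv[OF l] card .
  assume e: "e mod l = M mod l"
  have "?B \<subseteq> ?f ` ?A"
  proof
    fix m assume m: "m \<in> ?B"
    then have "m mod l = M mod l" using e by simp
    moreover have "m < M" using m by simp
    ultimately have "m div l < M div l"
      by (metis div_le_mono div_mult_mod_eq le_neq_implies_less less_imp_le nat_neq_iff)
    then have "m div l \<in> ?A" "m = ?f (m div l)" using m by simp_all
    then show "m \<in> ?f ` ?A" by blast
  qed
  with sub have "?B = ?f ` ?A" by blast
  then show "card {i. 1 \<le> i \<and> i < Suc M \<and> e \<in> packing n l i} = load n (M div l) (e div l)"
    unfolding card_packing_conv[OF l] using card by simp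
qed

text \<open>The value at 0 is a dummy that starts the summation by layers.\<close>

definition least_load :: "nat \<Rightarrow> nat \<Rightarrow> nat \<Rightarrow> nat" where
  "least_load n i t = (if t = 0 then 0 else if t \<le> n then min (load n i (2 * t)) (load n i (2 * t + 1)) else i)"

text \<open>By balance the least load is half the site load, rounded down, so monotonicity carries
  over. The last site is the bridge, which lies in every tree and so has the maximal load
  \<open>i\<close>.\<close>

lemma least_load_mono: "t < n + 1 \<Longrightarrow> least_load n i t \<le> least_load n i (Suc t)"
proof -
  assume t: "t < n + 1"
  have half: "min a b = (a + b) div 2" if "a \<le> b + 1 \<and> b \<le> a + 1" for a b :: nat
    using that by (simp add: min_def) presburger
  consider "t = 0" | "1 \<le> t" "t < n" | "1 \<le> t" "t = n" using t by linarith
  then show ?thesis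
  proof cases
    case 2
    then have "least_load n i t = site_load n i t div 2" "least_load n i (Suc t) = site_load n i (Suc t) div 2"
      using half[OF balanced[of t n i]] half[OF balanced[of "Suc t" n i]]
      by (simp_all add: least_load_def site_load_def)
    then show ?thesis using site_load_mono[of t n i] 2 by (simp add: div_le_mono)
  next
    case 3
    then show ?thesis using load_le[of n i "2 * n"] by (simp add: least_load_def min.coboundedI1)
  qed (simp add: least_load_def)
qed

lemma least_load_le:
  assumes "2 \<le> b" "b < 2 * n + 3"
  shows "least_load n i (site b) \<le> load n i b"
proof (cases "site b \<le> n")
  case True
  have "b = 2 * site b \<or> b = 2 * site b + 1" by (auto simp: site_def)
  then show ?thesis using True assms unfolding least_load_def by (auto simp: min_def)
next
  case False
  then have "b = 2 * n + 2" using assms by (auto simp: site_def)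
  then show ?thesis using load_bridge[of n i] load_le by (simp add: least_load_def site_def)
qed

text \<open>A vertex that climbs uses an edge of site \<open>t + 1\<close>, but the four tied loads
  agree, so its cost is still the least load of site \<open>t\<close>.\<close>

lemma load_parent_edge:
  assumes "1 \<le> t" "t \<le> n + 1"
  shows "load n i (parent_edge n (load n i) t) = least_load n i t"
proof (cases "t = n + 1")
  case True
  then show ?thesis using load_bridge[of n i] by (simp add: parent_edge_def least_load_def tied_def)
next
  case False
  then show ?thesis using assms
    by (cases t) (auto simp: parent_edge_def least_load_def tied_def min_def numeral_3_eq_3)
qed

text \<open>The chosen tree weighs exactly the sum of the least loads of all sites. No spanning tree
  weighs less: at least \<open>n + 1 - t\<close> of its edges lie beyond site \<open>t\<close>, and
  least loads are nondecreasing.\<close>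

lemma packing_greedy:
  assumes l: "1 \<le> l"
  shows "greedy_tree_packing (fan n l) (packing n l)"
  unfolding greedy_tree_packing_def
proof (intro allI impI)
  fix j :: nat assume j: "1 \<le> j"
  define M where "M = j - 1"
  define i where "i = M div l"
  define c where "c = M mod l"
  have c: "c < l" using l by (simp add: c_def)
  have jM: "j = Suc M" using j by (simp add: M_def)
  define w where "w e = card {i. 1 \<le> i \<and> i < j \<and> e \<in> packing n l i}" for e
  have P: "packing n l j = (\<lambda>t. parent_edge n (load n i) t * l + c) ` {1..n + 1}"
    by (simp add: packing_def copies_def base_tree_def jM i_def c_def image_image)
  have "(\<Sum>e\<in>packing n l j. w e) = (\<Sum>t\<in>{1..n + 1}. w (parent_edge n (load n i) t * l + c))"
    unfolding P using inj_on_parent_edge[OF c]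
    by (subst sum.reindex) (auto simp: o_def)
  also have "\<dots> = (\<Sum>t\<in>{1..n + 1}. least_load n i t)"
  proof (rule sum.cong[OF refl])
    fix t assume "t \<in> {1..n + 1}"
    then show "w (parent_edge n (load n i) t * l + c) = least_load n i t"
      using load_eq_card_packing[OF l, of "parent_edge n (load n i) t * l + c" M n] c load_parent_edge
      by (simp add: w_def jM i_def c_def)
  qed
  finally have weight: "(\<Sum>e\<in>packing n l j. w e) = (\<Sum>t=1..n + 1. least_load n i t)" .
  have "(\<Sum>e\<in>packing n l j. w e) \<le> (\<Sum>e\<in>T'. w e)" if T': "spanning_tree (fan n l) T'" for T'
  proof -
    have sub: "T' \<subseteq> edges (fan n l)" and con: "connected_by (fan n l) T'"
      using T' by (auto simp: spanning_tree_def)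
    have fin: "finite T'" using sub by (auto simp: fan_def intro: finite_subset)
    have b: "2 \<le> e div l" "e div l < 2 * n + 3" if "e \<in> T'" for e
      using that sub in_edges_fan_iff[OF l] by auto
    have "(\<Sum>t=1..n + 1. least_load n i t) \<le> (\<Sum>e\<in>T'. least_load n i (site (e div l)))"
    proof (rule sum_le_sum_comp[OF fin])
      show "(\<lambda>e. site (e div l)) ` T' \<subseteq> {..n + 1}" using b base_ends_properties(2) by auto
      show "least_load n i t \<le> least_load n i (Suc t)" if "t < n + 1" for t
        using that by (rule least_load_mono)
      show "n + 1 - t \<le> card {e \<in> T'. t < site (e div l)}" if "t < n + 1" for t
        using card_later_edges_ge[OF l sub con] that by simp
    qed (simp add: least_load_def)
    also have "\<dots> \<le> (\<Sum>e\<in>T'. w e)"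
    proof (rule sum_mono)
      fix e assume "e \<in> T'"
      then have "least_load n i (site (e div l)) \<le> load n i (e div l)" using b least_load_le by blast
      also have "\<dots> \<le> w e" using load_le_card_packing[OF l, of n M e] by (simp add: w_def jM i_def)
      finally show "least_load n i (site (e div l)) \<le> w e" .
    qed
    finally show ?thesis using weight by simp
  qed
  then show "min_spanning_tree (fan n l) (\<lambda>e. card {i. 1 \<le> i \<and> i < j \<and> e \<in> packing n l i}) (packing n l j)"
    using spanning_tree_base_tree[OF c] by (simp add: min_spanning_tree_def w_def packing_def jM c_def)
qed

section \<open>Edge connectivity of the fan\<close>

lemma bridge_copies_iff:
  fixes l :: nat
  assumes "1 \<le> l"
  shows "e \<in> {(2 * n + 2) * l..<(2 * n + 3) * l} \<longleftrightarrow> e div l = 2 * n + 2"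
  using assms less_eq_div_iff_mult_less_eq[of l "2 * n + 2" e] div_less_iff_less_mult[of l e "2 * n + 3"]
  by auto

text \<open>The \<open>l\<close> copies of the bridge separate vertex \<open>n + 1\<close>.
  Conversely, fewer than \<open>l\<close> edges miss some copy index \<open>c\<close> altogether, so
  copy \<open>c\<close> of a base tree survives their removal.\<close>

lemma edge_connectivity_fan:
  assumes l: "1 \<le> l"
  shows "edge_connectivity (fan n l) = l"
proof -
  let ?G = "fan n l"
  let ?C = "{F. F \<subseteq> edges ?G \<and> \<not> connected_by ?G (edges ?G - F)}"
  let ?bridge = "{(2 * n + 2) * l..<(2 * n + 3) * l}"
  have fin: "finite (edges ?G)" by (simp add: fan_def)
  note in_bridge = bridge_copies_iff[OF l, of _ n]
  have sub: "?bridge \<subseteq> edges ?G" using in_bridge in_edges_fan_iff[OF l] by auto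
  have "\<not> connected_by ?G (edges ?G - ?bridge)"
  proof
    assume "connected_by ?G (edges ?G - ?bridge)"
    from card_later_edges_ge[OF l _ this, of n]
    have "{e \<in> edges ?G - ?bridge. n < site (e div l)} \<noteq> {}" by (metis One_nat_def Diff_subset Suc_eq_plus1 card.empty diff_add_inverse le_add1 not_one_le_zero)
    then obtain e where e: "e \<in> edges ?G" "e \<notin> ?bridge" "n < site (e div l)" by blast
    then show False unfolding in_bridge in_edges_fan_iff[OF l] site_def by linarith
  qed
  moreover have "card ?bridge = l" by (simp add: algebra_simps)
  ultimately have "l \<in> card ` ?C" using sub by (intro image_eqI[of _ _ ?bridge]) auto
  moreover have "l \<le> card F" if F: "F \<in> ?C" for F
  proof (rule ccontr)
    assume "\<not> ?thesis"
    moreover have "card ((\<lambda>e. e mod l) ` F) \<le> card F"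
      using F fin by (intro card_image_le) (auto intro: finite_subset)
    ultimately have "card ((\<lambda>e. e mod l) ` F) < card {..<l}" by simp
    then have "\<not> {..<l} \<subseteq> (\<lambda>e. e mod l) ` F"
      using F fin card_mono[of "(\<lambda>e. e mod l) ` F" "{..<l}"] by (auto dest: finite_subset)
    then obtain c where c: "c < l" "c \<notin> (\<lambda>e. e mod l) ` F" by auto
    have "spanning_tree ?G (copies l c (base_tree n (load n 0)))" by (rule spanning_tree_base_tree[OF c(1)])
    then have "connected_by ?G (copies l c (base_tree n (load n 0)))"
      and "copies l c (base_tree n (load n 0)) \<subseteq> edges ?G" by (auto simp: spanning_tree_def)
    moreover have "copies l c (base_tree n (load n 0)) \<inter> F = {}" using c by (auto simp: in_copies_iff)
    ultimately have "connected_by ?G (edges ?G - F)" by (blast intro: connected_by_mono)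
    then show False using F by simp
  qed
  moreover have "finite ?C" using fin by (auto intro: finite_subset[of _ "Pow (edges ?G)"])
  ultimately show ?thesis unfolding edge_connectivity_def by (intro Min_eqI) auto
qed

section \<open>Ideal loads\<close>

lemma lookup_scaleR: "Poly_Mapping.lookup (r *\<^sub>R x) i = r * Poly_Mapping.lookup x i"
  unfolding scaleR_poly_mapping_def
  by (subst Abs_poly_mapping_inverse) (auto intro: finite_subset[OF _ finite_lookup[of x]])

lemma lookup_indicator_vec: "finite T \<Longrightarrow> Poly_Mapping.lookup (indicator_vec T) e = of_bool (e \<in> T)"
  by (simp add: indicator_vec_def lookup_sum lookup_single when_def of_bool_def)

text \<open>By convexity, \<open>u\<close> minimizes the norm as soon as its inner product with every spanning
  tree is at least its squared norm.\<close>

lemma lookup_ideal_loads_eqI: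
  assumes fin: "finite (edges G)" and u: "u \<in> spanning_tree_polytope G"
    and le: "\<And>T. spanning_tree G T \<Longrightarrow>
      (\<Sum>e\<in>edges G. (Poly_Mapping.lookup u e)\<^sup>2) \<le> (\<Sum>e\<in>T. Poly_Mapping.lookup u e)"
    and e: "e \<in> edges G"
  shows "Poly_Mapping.lookup (ideal_loads G) e = Poly_Mapping.lookup u e"
proof -
  define ip where "ip y = (\<Sum>e\<in>edges G. Poly_Mapping.lookup u e * Poly_Mapping.lookup y e)" for y
  define sq where "sq y = (\<Sum>e\<in>edges G. (Poly_Mapping.lookup y e)\<^sup>2)" for y :: "('a, real) poly_mapping"
  define y where "y = ideal_loads G"
  have lin: "ip (a *\<^sub>R x + b *\<^sub>R z) = a * ip x + b * ip z" for a b x z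
    by (simp add: ip_def lookup_add lookup_scaleR sum_distrib_left sum.distrib algebra_simps)
  have "convex {z. sq u \<le> ip z}"
  proof (rule convexI)
    fix x z and a b :: real
    assume "x \<in> {z. sq u \<le> ip z}" "z \<in> {z. sq u \<le> ip z}" "0 \<le> a" "0 \<le> b" "a + b = 1"
    then have "a * sq u + b * sq u \<le> a * ip x + b * ip z" by (intro add_mono mult_left_mono) auto
    moreover have "a * sq u + b * sq u = sq u" using \<open>a + b = 1\<close> by (metis distrib_right mult_1)
    ultimately show "a *\<^sub>R x + b *\<^sub>R z \<in> {z. sq u \<le> ip z}" by (simp add: lin)
  qed
  moreover have "indicator_vec T \<in> {z. sq u \<le> ip z}" if T: "spanning_tree G T" for T
  proof -
    have sub: "T \<subseteq> edges G" using T by (simp add: spanning_tree_def)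
    then have "finite T" using fin finite_subset by blast
    then have "ip (indicator_vec T) = (\<Sum>e\<in>edges G. if e \<in> T then Poly_Mapping.lookup u e else 0)"
      unfolding ip_def by (intro sum.cong refl) (simp add: lookup_indicator_vec)
    also have "\<dots> = (\<Sum>e\<in>T. Poly_Mapping.lookup u e)"
      using sub fin by (simp add: sum.inter_restrict[symmetric] Int_absorb1)
    finally show ?thesis using le[OF T] by (simp add: sq_def)
  qed
  ultimately have "spanning_tree_polytope G \<subseteq> {z. sq u \<le> ip z}"
    unfolding spanning_tree_polytope_def by (intro hull_minimal) auto
  then have ip: "sq u \<le> ip z" if "z \<in> spanning_tree_polytope G" for z using that by auto
  \<comment> \<open>This yields minimality of \<open>u\<close> and uniqueness as well: a point of
    norm at most that of \<open>u\<close> has distance 0 from it on the edges.\<close>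
  have dist: "(\<Sum>e\<in>edges G. (Poly_Mapping.lookup z e - Poly_Mapping.lookup u e)\<^sup>2) \<le> sq z - sq u"
    if "z \<in> spanning_tree_polytope G" for z
  proof -
    have "(\<Sum>e\<in>edges G. (Poly_Mapping.lookup z e - Poly_Mapping.lookup u e)\<^sup>2) = sq z - 2 * ip z + sq u"
      by (simp add: sq_def ip_def power2_diff sum.distrib sum_subtractf sum_distrib_left mult_ac)
    then show ?thesis using ip[OF that] by simp
  qed
  let ?f = "\<lambda>x. L2_set (Poly_Mapping.lookup x) (edges G)"
  have f: "?f x \<le> ?f z \<longleftrightarrow> sq x \<le> sq z" for x z :: "('a, real) poly_mapping"
    by (simp add: L2_set_def sq_def)
  have "sq u \<le> sq z" if "z \<in> spanning_tree_polytope G" for z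
  proof -
    have "0 \<le> (\<Sum>e\<in>edges G. (Poly_Mapping.lookup z e - Poly_Mapping.lookup u e)\<^sup>2)"
      by (intro sum_nonneg) simp
    then show ?thesis using dist[OF that] by simp
  qed
  \<comment> \<open>The ideal loads are defined by choice, so a minimizer must be exhibited before
    they are known to be one.\<close>
  then have "is_arg_min ?f (\<lambda>x. x \<in> spanning_tree_polytope G) u"
    using u f by (auto simp: is_arg_min_linorder)
  then have "is_arg_min ?f (\<lambda>x. x \<in> spanning_tree_polytope G) y"
    unfolding y_def ideal_loads_def arg_min_on_def arg_min_def by (rule someI)
  then have y: "y \<in> spanning_tree_polytope G" "sq y \<le> sq u"
    using u f by (auto simp: is_arg_min_linorder)
  then have "(\<Sum>e\<in>edges G. (Poly_Mapping.lookup y e - Poly_Mapping.lookup u e)\<^sup>2) = 0"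
    using dist[OF y(1)] by (intro antisym sum_nonneg) auto
  then show ?thesis using fin e by (simp add: sum_nonneg_eq_0_iff y_def)
qed

lemma sum_of_bool_eq_card:
  assumes "finite A"
  shows "(\<Sum>x\<in>A. of_bool (P x) :: real) = real (card {x \<in> A. P x})"
  using assms
proof (induction A rule: finite_induct)
  case (insert a A)
  have "{x \<in> insert a A. P x} = (if P a then insert a {x \<in> A. P x} else {x \<in> A. P x})" by auto
  with insert show ?case by simp
qed simp

text \<open>The rims form a spanning path and the spokes together with the bridge a spanning star;
  the ideal loads are the average over all copies of both.\<close>

lemma ideal_loads_fan:
  assumes l: "1 \<le> l" and e: "e \<in> edges (fan n l)" "e div l \<noteq> 2 * n + 2"
  shows "Poly_Mapping.lookup (ideal_loads (fan n l)) e = 1 / (2 * real l)"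
proof -
  let ?G = "fan n l"
  define spoke where "spoke t = (if t = n + 1 then 2 * t else 2 * t + 1)" for t
  define path where "path = (\<lambda>t. 2 * t) ` {1..n + 1}"
  define star where "star = spoke ` {1..n + 1}"
  define u where "u = (\<Sum>c<l. (1 / real l) *\<^sub>R ((1 / 2) *\<^sub>R indicator_vec (copies l c path)
    + (1 / 2) *\<^sub>R indicator_vec (copies l c star)))"
  have fin: "finite (edges ?G)" by (simp add: fan_def)
  have "spanning_tree ?G (copies l c path)" if c: "c < l" for c
    unfolding path_def using base_ends_rim
    by (intro spanning_tree_copies[OF l c, where par = "\<lambda>t. t - 1" and \<rho> = "\<lambda>t. t"]) auto
  moreover have "spanning_tree ?G (copies l c star)" if c: "c < l" for c
    unfolding star_def using base_ends_rim[of "n + 1"] base_ends_spoke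
    by (intro spanning_tree_copies[OF l c, where par = "\<lambda>t. if t = n + 1 then n else 0" and \<rho> = "\<lambda>t. t"])
      (auto simp: spoke_def)
  ultimately have polytope: "u \<in> spanning_tree_polytope ?G"
    unfolding u_def spanning_tree_polytope_def using l
    by (intro convex_sum convex_convex_hull convexD[OF convex_convex_hull] hull_inc imageI) auto
  have fin_copies: "finite (copies l c path)" "finite (copies l c star)" for c
    by (simp_all add: copies_def path_def star_def)
  \<comment> \<open>The bridge belongs to both trees, so its copies get twice the load of the other
    edges.\<close>
  have path_star: "of_bool (b \<in> path) + of_bool (b \<in> star) = (1 + of_bool (b = 2 * n + 2) :: real)"
    if b: "2 \<le> b" "b < 2 * n + 3" for b
  proof -
    have "b \<in> path \<longleftrightarrow> even b"
      using b by (auto simp: path_def image_iff elim!: evenE)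
    moreover have "b \<in> star \<longleftrightarrow> odd b \<or> b = 2 * n + 2"
    proof
      assume "odd b \<or> b = 2 * n + 2"
      then have "b = spoke (b div 2)" "b div 2 \<in> {1..n + 1}" using b by (auto simp: spoke_def)
      then show "b \<in> star" unfolding star_def by (rule image_eqI)
    qed (auto simp: star_def spoke_def)
    ultimately show ?thesis by auto
  qed
  have u: "Poly_Mapping.lookup u e = (1 + of_bool (e div l = 2 * n + 2)) / (2 * real l)"
    if e: "e \<in> edges ?G" for e
  proof -
    have "Poly_Mapping.lookup u e = (\<Sum>c<l. if c = e mod l
      then (of_bool (e div l \<in> path) + of_bool (e div l \<in> star)) / (2 * real l) else 0)"
      unfolding u_def lookup_sum
      by (intro sum.cong refl)
        (auto simp: lookup_scaleR lookup_add lookup_indicator_vec[OF fin_copies(1)]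
          lookup_indicator_vec[OF fin_copies(2)] in_copies_iff field_simps)
    also have "\<dots> = (of_bool (e div l \<in> path) + of_bool (e div l \<in> star)) / (2 * real l)"
      using l by simp
    finally show ?thesis using path_star e in_edges_fan_iff[OF l] by simp
  qed
  note sum_bool = sum_of_bool_eq_card[of _ "\<lambda>e. e div l = 2 * n + 2"]
  have "{e \<in> edges ?G. e div l = 2 * n + 2} = {(2 * n + 2) * l..<(2 * n + 3) * l}"
    by (rule set_eqI) (unfold mem_Collect_eq in_edges_fan_iff[OF l] bridge_copies_iff[OF l], linarith)
  then have card_bridge: "card {e \<in> edges ?G. e div l = 2 * n + 2} = l" by (simp add: algebra_simps)
  have card_edges: "card (edges ?G) = (2 * n + 1) * l" by (simp add: fan_def algebra_simps)
  \<comment> \<open>The factor 3 comes from \<open>(1 + x)\<^sup>2 = 1 + 3 * x\<close> for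
    \<open>x\<close> in \<open>{0, 1}\<close>.\<close>
  have "(\<Sum>e\<in>edges ?G. (Poly_Mapping.lookup u e)\<^sup>2)
    = (\<Sum>e\<in>edges ?G. (1 + 3 * of_bool (e div l = 2 * n + 2)) / (4 * (real l)\<^sup>2))"
    by (intro sum.cong refl) (auto simp: u power2_eq_square)
  also have "\<dots> = (real (card (edges ?G)) + 3 * real l) / (4 * (real l)\<^sup>2)"
    using sum_bool[OF fin] card_bridge by (simp add: sum_divide_distrib[symmetric] sum.distrib sum_distrib_left[symmetric])
  also have "\<dots> = (real n + 2) / (2 * real l)"
    using l unfolding card_edges by (simp add: field_simps power2_eq_square)
  finally have norm: "(\<Sum>e\<in>edges ?G. (Poly_Mapping.lookup u e)\<^sup>2) = (real n + 2) / (2 * real l)" .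
  have "(\<Sum>e\<in>edges ?G. (Poly_Mapping.lookup u e)\<^sup>2) \<le> (\<Sum>e\<in>T. Poly_Mapping.lookup u e)"
    if T: "spanning_tree ?G T" for T
  proof -
    have sub: "T \<subseteq> edges ?G" and con: "connected_by ?G T" using T by (auto simp: spanning_tree_def)
    have finT: "finite T" using sub fin finite_subset by blast
    \<comment> \<open>A spanning tree has at least \<open>n + 1\<close> edges, one of which is a
      bridge copy and counts twice; this matches the squared norm.\<close>
    have "n + 1 \<le> card {e \<in> T. 0 < site (e div l)}" using card_later_edges_ge[OF l sub con, of 0] by simp
    also have "\<dots> \<le> card T" using finT by (intro card_mono) auto
    finally have "n + 1 \<le> card T" .
    moreover have "1 \<le> card {e \<in> T. n < site (e div l)}" using card_later_edges_ge[OF l sub con, of n] by simp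
    moreover have "{e \<in> T. n < site (e div l)} \<subseteq> {e \<in> T. e div l = 2 * n + 2}"
      using sub by (auto simp: in_edges_fan_iff[OF l] site_def subset_iff)
    then have "card {e \<in> T. n < site (e div l)} \<le> card {e \<in> T. e div l = 2 * n + 2}"
      using finT by (intro card_mono) auto
    ultimately have "real n + 2 \<le> real (card T) + real (card {e \<in> T. e div l = 2 * n + 2})" by linarith
    also have "\<dots> = (\<Sum>e\<in>T. 1 + of_bool (e div l = 2 * n + 2))"
      using sum_bool[OF finT] by (simp add: sum.distrib)
    finally have "(real n + 2) / (2 * real l) \<le> (\<Sum>e\<in>T. 1 + of_bool (e div l = 2 * n + 2)) / (2 * real l)"
      by (intro divide_right_mono) auto
    also have "\<dots> = (\<Sum>e\<in>T. Poly_Mapping.lookup u e)"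
      unfolding sum_divide_distrib using u sub by (intro sum.cong refl) auto
    finally show ?thesis using norm by simp
  qed
  from lookup_ideal_loads_eqI[OF fin polytope this e(1)] show ?thesis
    using u[OF e(1)] e(2) by simp
qed

section \<open>The lower bound\<close>

lemma edge_error_le_load_error:
  assumes l: "1 \<le> l" and e: "e \<in> edges (fan n l)" "e div l \<noteq> 2 * n + 2"
  shows "\<bar>relative_load (packing n l) k e - 1 / (2 * real l)\<bar> \<le> load_error (fan n l) (packing n l) k"
proof -
  have "finite (edges (fan n l))" by (simp add: fan_def)
  then have "\<bar>relative_load (packing n l) k e - Poly_Mapping.lookup (ideal_loads (fan n l)) e\<bar>
      \<le> load_error (fan n l) (packing n l) k"
    unfolding load_error_def using e(1) by (intro Max_ge) auto
  then show ?thesis using ideal_loads_fan[OF assms] by simp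
qed

text \<open>An edge of the first tree has load at least 1, while its ideal share is \<open>k / (2 * l)\<close>,
  which is at most \<open>1 / 2\<close>.\<close>

lemma load_error_early:
  assumes l: "1 \<le> l" and n: "2 \<le> n" and k: "1 \<le> k" "k \<le> l"
  shows "1 / (2 * real k) \<le> load_error (fan n l) (packing n l) k"
proof -
  \<comment> \<open>In the first step sites 1 and 2 are tied, so vertex 1 climbs along the rim of
    site 2.\<close>
  have "parent_edge n (load n 0) 1 = 4" using n by (simp add: parent_edge_def tied_def)
  then have "4 \<in> base_tree n (load n 0)" unfolding base_tree_def by (metis atLeastAtMost_iff imageI le_add2 order_refl)
  then have "4 * l \<in> packing n l 1" using l by (simp add: packing_def in_copies_iff)
  then have "{1} \<subseteq> {i. 1 \<le> i \<and> i \<le> k \<and> 4 * l \<in> packing n l i}" using k by simp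
  then have "card {1::nat} \<le> card {i. 1 \<le> i \<and> i \<le> k \<and> 4 * l \<in> packing n l i}"
    by (intro card_mono) (auto intro: finite_subset[of _ "{..k}"])
  then have "1 / real k \<le> relative_load (packing n l) k (4 * l)"
    unfolding relative_load_def by (intro divide_right_mono) auto
  moreover have "4 * l \<in> edges (fan n l)" "4 * l div l \<noteq> 2 * n + 2"
    using l n by (auto simp: in_edges_fan_iff)
  moreover have "1 / (2 * real l) \<le> 1 / (2 * real k)" using k by (simp add: frac_le)
  moreover have "1 / real k = 1 / (2 * real k) + 1 / (2 * real k)" by simp
  ultimately show ?thesis using edge_error_le_load_error[OF l, of "4 * l" n k] by linarith
qed

text \<open>One edge of site 1 has at most half of the site load \<open>i - flux n i 1\<close>,
  where \<open>i = k div l\<close>. Its copy whose turn is next has just this load, whereas the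
  ideal share \<open>k / (2 * l)\<close> is at least \<open>i / 2\<close>.\<close>

lemma load_error_late:
  assumes l: "1 \<le> l" and n: "2 \<le> n" and k: "l \<le> k"
  shows "real (flux n (k div l) 1) / (2 * real k) \<le> load_error (fan n l) (packing n l) k"
proof -
  define i where "i = k div l"
  have "load n i 2 + load n i 3 + flux n i 1 = i"
    using sum_site_load_flux[of 1 n i] n by (simp add: site_load_def numeral_3_eq_3 numeral_2_eq_2)
  then obtain b where b: "b = 2 \<or> b = 3" "2 * load n i b + flux n i 1 \<le> i"
    by (metis (no_types, lifting) add.commute add_le_cancel_right le_add_diff_inverse linorder_linear mult_2 add_left_mono nat_le_linear)
  define e where "e = b * l + k mod l"
  have e: "e div l = b" "e mod l = k mod l" using l by (auto simp: e_def)
  have "card {j. 1 \<le> j \<and> j \<le> k \<and> e \<in> packing n l j} = load n i b"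
    using load_eq_card_packing[OF l e(2), of n] e(1) by (simp add: i_def less_Suc_eq_le)
  then have rel: "relative_load (packing n l) k e = real (load n i b) / real k"
    by (simp add: relative_load_def)
  have "i * l \<le> k" by (simp add: i_def div_times_less_eq_dividend)
  then have "real i * real l \<le> real k" by (metis of_nat_le_iff of_nat_mult)
  then have "real i \<le> real k / real l" using l by (simp add: field_simps)
  moreover have "real (2 * load n i b + flux n i 1) \<le> real i" using b(2) by (rule of_nat_mono)
  ultimately have "real (flux n i 1) \<le> real k / real l - 2 * real (load n i b)" by simp
  then have "real (flux n i 1) / (2 * real k) \<le> (real k / real l - 2 * real (load n i b)) / (2 * real k)"
    by (intro divide_right_mono) auto
  also have "\<dots> = 1 / (2 * real l) - real (load n i b) / real k"
    using l k by (simp add: field_simps)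
  also have "\<dots> \<le> load_error (fan n l) (packing n l) k"
    using edge_error_le_load_error[OF l, of e n k] b n e(1) rel in_edges_fan_iff[OF l] by auto
  finally show ?thesis by (simp add: i_def)
qed

text \<open>The early bound settles \<open>k \<le> l\<close>. Otherwise
  \<open>k \<le> 2 * (i * l)\<close> and \<open>i \<le> 72 * a\<^sup>2\<close> give
  \<open>k \<le> 144 * a\<^sup>2 * l\<close>; the root 12 and the factor 2 of the late bound make
  \<open>1 / 24\<close>.\<close>

lemma load_error_fan:
  assumes l: "1 \<le> l" and n: "2 \<le> n" and k: "1 \<le> k" "real k \<le> 1 / 16 * real (n + 2) ^ 2"
  shows "1 / 24 * sqrt (1 / (real k * real l)) \<le> load_error (fan n l) (packing n l) k"
proof (cases "k \<le> l")
  case True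
  have "sqrt (1 / (real k * real l)) \<le> sqrt ((1 / real k)\<^sup>2)"
    unfolding real_sqrt_le_iff power2_eq_square using True k by (simp add: frac_le mult_mono)
  also have "\<dots> = 1 / real k" by (simp only: real_sqrt_abs) simp
  finally have "1 / 24 * sqrt (1 / (real k * real l)) \<le> 1 / 24 * (1 / real k)" by simp
  also have "\<dots> \<le> 1 / (2 * real k)" using k(1) by (simp add: field_simps)
  finally show ?thesis using load_error_early[OF l n k(1) True] by linarith
next
  case False
  define i where "i = k div l"
  define a where "a = flux n i 1"
  have "1 \<le> i" using False l by (simp add: i_def Suc_le_eq div_greater_zero_iff)
  moreover have "4 * i \<le> n\<^sup>2"
  proof -
    \<comment> \<open>Since \<open>n + 2 \<le> 2 * n\<close>, the constant \<open>1 / 16\<close>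
      yields the \<open>4 * k \<le> n\<^sup>2\<close> that the deficit estimate asks for.\<close>
    have "real (n + 2) ^ 2 \<le> (2 * real n) ^ 2" using n by (intro power_mono) auto
    then have "4 * real k \<le> real n ^ 2" using k(2) by (simp add: power2_eq_square)
    then have "4 * k \<le> n\<^sup>2" by (metis of_nat_le_iff of_nat_mult of_nat_numeral of_nat_power)
    moreover have "i \<le> k" by (simp add: i_def)
    ultimately show ?thesis by simp
  qed
  ultimately have a: "i \<le> 72 * a\<^sup>2" using deficit_lower[OF n] by (simp add: a_def)
  have "k = i * l + k mod l" by (simp add: i_def)
  moreover have "k mod l < l" using l by simp
  moreover have "l \<le> i * l" using \<open>1 \<le> i\<close> by simp
  ultimately have "k \<le> 2 * (i * l)" by linarith
  also have "\<dots> \<le> 144 * a\<^sup>2 * l" using a mult_le_mono1[OF a, of l] by simp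
  finally have "real k \<le> real (144 * a\<^sup>2 * l)" by (rule of_nat_mono)
  then have "real k \<le> 144 * (real a)\<^sup>2 * real l" by simp
  then have "1 / (real k * real l) \<le> (12 * real a / real k)\<^sup>2"
    using l k(1) by (simp add: field_simps power2_eq_square)
  then have "sqrt (1 / (real k * real l)) \<le> 12 * real a / real k"
    by (intro real_le_lsqrt) auto
  then have "1 / 24 * sqrt (1 / (real k * real l)) \<le> 1 / 24 * (12 * real a / real k)" by simp
  also have "\<dots> = real a / (2 * real k)" by simp
  also have "\<dots> \<le> load_error (fan n l) (packing n l) k"
    using load_error_late[OF l n, of k] False by (simp add: a_def i_def)
  finally show ?thesis .
qed


theorem theorem2:
  shows "\<exists>(\<F> :: ((nat, nat) multigraph \<times> (nat \<Rightarrow> nat set)) set) (c :: real) (C :: real).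
    c > 0 \<and> C > 0 \<and>
    (\<forall>(G, T)\<in>\<F>. wf_multigraph G \<and> card (verts G) \<ge> 2 \<and> connected_by G (edges G) \<and>
        greedy_tree_packing G T) \<and>
    (\<forall>l\<ge>1. \<forall>N. \<exists>(G, T)\<in>\<F>. edge_connectivity G = l \<and> card (verts G) \<ge> N) \<and>
    (\<forall>(G, T)\<in>\<F>. \<forall>k::nat. 1 \<le> k \<and> real k \<le> C * real (card (verts G)) ^ 2 \<longrightarrow>
        load_error G T k \<ge> c * sqrt (1 / (real k * real (edge_connectivity G))))"
  proof (intro exI conjI)
  let ?F = "{(fan n l, packing n l) | n l. 2 \<le> n \<and> 1 \<le> l}"
  show "(1 / 24 :: real) > 0" "(1 / 16 :: real) > 0" by simp_all
  show "\<forall>(G, T)\<in>?F. wf_multigraph G \<and> card (verts G) \<ge> 2 \<and> connected_by G (edges G) \<and>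
      greedy_tree_packing G T"
  proof safe
    fix n l :: nat assume n: "2 \<le> n" and l: "1 \<le> l"
    show "wf_multigraph (fan n l)" by (rule wf_fan[OF l])
    show "card (verts (fan n l)) \<ge> 2" by simp
    show "greedy_tree_packing (fan n l) (packing n l)" by (rule packing_greedy[OF l])
    have "spanning_tree (fan n l) (copies l 0 (base_tree n (load n 0)))"
      using l by (intro spanning_tree_base_tree) simp
    then show "connected_by (fan n l) (edges (fan n l))"
      unfolding spanning_tree_def by (blast intro: connected_by_mono)
  qed
  show "\<forall>l\<ge>1. \<forall>N. \<exists>(G, T)\<in>?F. edge_connectivity G = l \<and> card (verts G) \<ge> N"
  proof (intro allI impI)
    fix l N :: nat assume l: "1 \<le> l"
    have "(fan (N + 2) l, packing (N + 2) l) \<in> ?F" using l by force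
    moreover have "edge_connectivity (fan (N + 2) l) = l" "card (verts (fan (N + 2) l)) \<ge> N"
      using edge_connectivity_fan[OF l] by simp_all
    ultimately show "\<exists>(G, T)\<in>?F. edge_connectivity G = l \<and> card (verts G) \<ge> N" by blast
  qed
  show "\<forall>(G, T)\<in>?F. \<forall>k::nat. 1 \<le> k \<and> real k \<le> 1 / 16 * real (card (verts G)) ^ 2 \<longrightarrow>
      load_error G T k \<ge> 1 / 24 * sqrt (1 / (real k * real (edge_connectivity G)))"
  proof safe
    fix n l k :: nat
    assume n: "2 \<le> n" and l: "1 \<le> l" and k: "1 \<le> k" "real k \<le> 1 / 16 * real (card (verts (fan n l))) ^ 2"
    have "card (verts (fan n l)) = n + 2" by simp
    then show "1 / 24 * sqrt (1 / (real k * real (edge_connectivity (fan n l))))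
        \<le> load_error (fan n l) (packing n l) k"
      using load_error_fan[OF l n k(1)] k(2) by (simp add: edge_connectivity_fan[OF l])
  qed
qed

end
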